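(* $$1-\cfrac{1}{1+K_{n=1}^{\infty}\dfrac{n^2}{n^2+2n}}=J_0(2),$$ where $J_0(x)$ is the Bessel function of the first kind of order $0$.
   Context: For sequences $\{a_n\}_{n\ge1}$, $\{b_n\}_{n\ge1}$, $K_{n=1}^{\infty}\frac{a_n}{b_n}$ denotes the limit as $N\to\infty$ (which is asserted to exist) of the finite continued fractions $\cfrac{a_1}{b_1+\cfrac{a_2}{b_2+\cdots+\cfrac{a_N}{b_N}}}$. The Bessel function is $J_0(x)=\sum_{k=0}^{\infty}\frac{(-1)^k}{(k!)^2}\left(\frac x2\right)^{2k}$. *)

theory Defs
  imports Complex_Main
begin

(* cf_segment a b k m is the finite continued fraction with the m partial
   quotients a k / b k, ..., a (k + m - 1) / b (k + m - 1):
     a k / (b k + a (k + 1) / (b (k + 1) + ... )). *)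
fun cf_segment :: "(nat \<Rightarrow> real) \<Rightarrow> (nat \<Rightarrow> real) \<Rightarrow> nat \<Rightarrow> nat \<Rightarrow> real" where
  "cf_segment a b k 0 = 0"
| "cf_segment a b k (Suc m) = a k / (b k + cf_segment a b (Suc k) m)"

definition cf_approximant :: "(nat \<Rightarrow> real) \<Rightarrow> (nat \<Rightarrow> real) \<Rightarrow> nat \<Rightarrow> real" where
  "cf_approximant a b N = cf_segment a b 1 N"

definition cf_convergent :: "(nat \<Rightarrow> real) \<Rightarrow> (nat \<Rightarrow> real) \<Rightarrow> bool" where
  "cf_convergent a b \<longleftrightarrow> convergent (cf_approximant a b)"

(* Only meaningful together with cf_convergent a b. *)
definition cf_value :: "(nat \<Rightarrow> real) \<Rightarrow> (nat \<Rightarrow> real) \<Rightarrow> real" where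
  "cf_value a b = lim (cf_approximant a b)"

definition Bessel_J0 :: "real \<Rightarrow> real" where
  "Bessel_J0 x = (\<Sum>k. (-1) ^ k / (fact k)\<^sup>2 * (x / 2) ^ (2 * k))"

end

(* Euler's correspondence between series and continued fractions turns the N-th approximant of the
   continued fraction into a partial sum of the alternating series for 1 - J0(2). In the
   continued fraction that starts at index k, with value C, the quantity k^2 / (k^2 + C)
   satisfies the Horner recursion S(k) = 1 - S(k + 1) / (k + 1)^2. *)

theory Submission
  imports Defs
begin

lemma cf_segment_nonneg:
  assumes "\<And>n. a n \<ge> 0" "\<And>n. b n \<ge> 0"
  shows "cf_segment a b k m \<ge> 0"
  by (induction m arbitrary: k) (simp_all add: assms)

text \<open>Dropping the nonnegative tail from the denominator can only increase the fraction. This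
  bound later keeps the limit of \<open>1 / (1 + C N)\<close> away from 0.\<close>

lemma cf_segment_Suc_le:
  assumes "\<And>n. a n \<ge> 0" "\<And>n. b n \<ge> 0" "b k > 0"
  shows "cf_segment a b k (Suc m) \<le> a k / b k"
  using assms cf_segment_nonneg[of a b "Suc k" m] by (simp add: frac_le)

text \<open>The start index \<open>k\<close> varies in the induction because peeling off the first
  partial quotient shifts it. At \<open>k = 0\<close> the left side would be 0 by division by
  zero.\<close>

lemma euler_cf_segment:
  fixes k m :: nat
  assumes "k > 0"
  shows "(real k)\<^sup>2 / ((real k)\<^sup>2
           + cf_segment (\<lambda>n. (real n)\<^sup>2) (\<lambda>n. (real n)\<^sup>2 + 2 * real n) k m)
         = (\<Sum>j\<le>m. (-1) ^ j * (fact k)\<^sup>2 / (fact (k + j))\<^sup>2)"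
  using assms
proof (induction m arbitrary: k)
  case 0
  then show ?case by simp
next
  case (Suc m)
  define C where "C = cf_segment (\<lambda>n. (real n)\<^sup>2) (\<lambda>n. (real n)\<^sup>2 + 2 * real n) (Suc k) m"
  define S where "S = (\<Sum>j\<le>m. (-1) ^ j * (fact (Suc k))\<^sup>2 / (fact (Suc k + j))\<^sup>2 :: real)"
  have C: "C \<ge> 0"
    unfolding C_def by (rule cf_segment_nonneg) auto
  have S: "S = (real k + 1)\<^sup>2 / ((real k + 1)\<^sup>2 + C)"
    using Suc.IH[of "Suc k"] by (simp add: C_def S_def add.commute)
  define x where "x = real k"
  have x: "x > 0" using Suc.prems by (simp add: x_def)
  have pos: "x\<^sup>2 + 2 * x + C > 0" "(x + 1)\<^sup>2 + C > 0"
    using x C by (simp_all add: add_pos_nonneg add_pos_pos)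
  have "x\<^sup>2 + x\<^sup>2 / (x\<^sup>2 + 2 * x + C) = x\<^sup>2 * (((x + 1)\<^sup>2 + C) / (x\<^sup>2 + 2 * x + C))"
    using pos by (simp add: field_simps power2_eq_square)
  then have "x\<^sup>2 / (x\<^sup>2 + x\<^sup>2 / (x\<^sup>2 + 2 * x + C)) = (x\<^sup>2 + 2 * x + C) / ((x + 1)\<^sup>2 + C)"
    using x by simp
  \<comment> \<open>The partial denominator is \<open>(x + 1)\<^sup>2 - 1\<close>, so the numerator
    is the denominator minus 1.\<close>
  also have "\<dots> = 1 - 1 / ((x + 1)\<^sup>2 + C)"
    using pos by (simp add: field_simps power2_eq_square)
  also have "\<dots> = 1 - S / (x + 1)\<^sup>2"
    using x S by (simp add: x_def)
  \<comment> \<open>Dividing by \<open>(x + 1)\<^sup>2\<close> turns the square of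
    \<open>fact (Suc k)\<close> into that of \<open>fact k\<close>; the leading 1 becomes the term
    \<open>j = 0\<close>.\<close>
  also have "\<dots> = 1 + (\<Sum>j\<le>m. (-1) ^ Suc j * (fact k)\<^sup>2 / (fact (k + Suc j))\<^sup>2)"
  proof -
    have "(fact (Suc k))\<^sup>2 / (x + 1)\<^sup>2 = (fact k :: real)\<^sup>2"
      using x by (simp add: x_def power_mult_distrib add.commute)
    then have "(-1) ^ j * (fact (Suc k))\<^sup>2 / (fact (Suc k + j))\<^sup>2 / (x + 1)\<^sup>2
                 = (-1) ^ j * (fact k)\<^sup>2 / (fact (Suc k + j) :: real)\<^sup>2" for j
      by (metis divide_divide_eq_left' divide_divide_eq_left times_divide_eq_right)
    then have "S / (x + 1)\<^sup>2 = (\<Sum>j\<le>m. (-1) ^ j * (fact k)\<^sup>2 / (fact (Suc k + j))\<^sup>2)"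
      unfolding S_def sum_divide_distrib by (simp only:)
    then show ?thesis by (simp add: sum_negf)
  qed
  also have "\<dots> = (\<Sum>j\<le>Suc m. (-1) ^ j * (fact k)\<^sup>2 / (fact (k + j))\<^sup>2)"
    by (subst sum.atMost_Suc_shift) simp
  finally show ?case by (simp add: x_def C_def)
qed

text \<open>At 2 every power of \<open>x / 2\<close> is 1; the exponential series at 1
  dominates.\<close>

lemma sums_Bessel_J0_2: "(\<lambda>k. (-1) ^ k / (fact k)\<^sup>2) sums Bessel_J0 2"
proof -
  have "summable (\<lambda>k. (-1) ^ k / (fact k)\<^sup>2 :: real)"
  proof (rule summable_comparison_test')
    show "summable (\<lambda>k. inverse (fact k) :: real)"
      using summable_exp[of "1::real"] by simp
    show "norm ((-1) ^ k / (fact k)\<^sup>2 :: real) \<le> inverse (fact k)" if "k \<ge> 0" for k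
      by (simp add: power2_eq_square field_simps)
  qed
  then show ?thesis by (simp add: Bessel_J0_def summable_sums)
qed

theorem mainTheorem6:
  "cf_convergent (\<lambda>n. (real n)\<^sup>2) (\<lambda>n. (real n)\<^sup>2 + 2 * real n)
    \<and> 1 - 1 / (1 + cf_value (\<lambda>n. (real n)\<^sup>2) (\<lambda>n. (real n)\<^sup>2 + 2 * real n))
        = Bessel_J0 2"
proof -
  let ?a = "\<lambda>n. (real n)\<^sup>2" and ?b = "\<lambda>n. (real n)\<^sup>2 + 2 * real n"
  define C where "C = cf_approximant ?a ?b"
  define L where "L = 1 - Bessel_J0 2"
  have C_nonneg: "C N \<ge> 0" for N
    unfolding C_def cf_approximant_def by (rule cf_segment_nonneg) auto
  \<comment> \<open>For positive \<open>N\<close> the bound is the first partial quotient, 1/3; for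
    \<open>N = 0\<close> the approximant is 0.\<close>
  have "C N \<le> 1 / 3" for N
    unfolding C_def cf_approximant_def
    using cf_segment_Suc_le[of ?a ?b 1 "N - 1"] by (cases N) auto
  then have S_ge: "1 / (1 + C N) \<ge> 3 / 4" for N
    using C_nonneg[of N] by (simp add: field_simps)
  have partial_sums: "1 / (1 + C N) = (\<Sum>j\<le>N. - ((-1) ^ Suc j / (fact (Suc j))\<^sup>2))" for N
    using euler_cf_segment[of 1 N] by (simp add: C_def cf_approximant_def)
  \<comment> \<open>Removing the zeroth term of the Bessel series, which is 1, leaves the negated
    series for \<open>L\<close>.\<close>
  have "(\<lambda>j. (-1) ^ Suc j / (fact (Suc j))\<^sup>2) sums (Bessel_J0 2 - 1)"
    using sums_Bessel_J0_2 by (subst sums_Suc_iff) simp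
  from sums_minus[OF this] have S_lim: "(\<lambda>N. 1 / (1 + C N)) \<longlonglongrightarrow> L"
    unfolding partial_sums sums_def_le L_def by simp
  \<comment> \<open>A nonzero \<open>L\<close> permits taking reciprocals in the limit, which
    recovers \<open>C N\<close> and proves that it converges.\<close>
  have "L \<ge> 3 / 4"
    by (rule LIMSEQ_le_const[OF S_lim]) (use S_ge in blast)
  then have "L \<noteq> 0" by simp
  then have "(\<lambda>N. 1 / (1 / (1 + C N)) - 1) \<longlonglongrightarrow> 1 / L - 1"
    by (intro tendsto_intros S_lim)
  then have C_lim: "C \<longlonglongrightarrow> 1 / L - 1" by simp
  then have "cf_value ?a ?b = 1 / L - 1"
    unfolding cf_value_def C_def by (rule limI)
  moreover have "cf_convergent ?a ?b"
    using C_lim unfolding cf_convergent_def C_def by (rule convergentI)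
  ultimately show ?thesis by (simp add: L_def)
qed

end
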